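(* Let $n\ge 3$ and $1\le r\le n-2$ be odd integers, and let $K_n$ be the complete graph on $n$ vertices. Then \[ cms_r(K_n)=\left\lfloor \frac{rn-1}{2}\right\rfloor \quad\text{if and only if}\quad cms_{n-1-r}(K_n)=\left\lfloor \frac{(n-1-r)n-1}{2}\right\rfloor. \]
   Context: All graphs are simple. For an integer $N$, $[N]=\{0,1,\dots,N-1\}$. An ordering of a graph $G=(V,E)$ is a bijection $\ell:E\to[|E|]$; edges are cyclically consecutive in $\ell$ if their labels are consecutive integers modulo $|E|$. A graph is $(\le r)$-regular if every vertex has degree at most $r$. For an ordering $\ell$ of $G$, $cms_r(\ell)$ is the largest integer $s$ such that every $s$ cyclically consecutive edges of $\ell$ form a $(\le r)$-regular subgraph of $G$; $cms_r(G)$ is the maximum of $cms_r(\ell)$ over all orderings $\ell$ of $G$. *)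

theory Defs
  imports Complex_Main
begin

text \<open>A graph is a pair of a vertex set and a set of edges, each edge being the two-element set
  of its endpoints.\<close>

type_synonym 'a ugraph = "'a set \<times> 'a set set"

abbreviation verts :: "'a ugraph \<Rightarrow> 'a set" where "verts G \<equiv> fst G"
abbreviation edges :: "'a ugraph \<Rightarrow> 'a set set" where "edges G \<equiv> snd G"

definition simple_graph :: "'a ugraph \<Rightarrow> bool" where
  "simple_graph G \<longleftrightarrow> finite (verts G) \<and> (\<forall>e\<in>edges G. e \<subseteq> verts G \<and> card e = 2)"

definition complete_graph :: "nat \<Rightarrow> nat ugraph" where
  "complete_graph n = ({..<n}, {e. e \<subseteq> {..<n} \<and> card e = 2})"

definition degree :: "'a ugraph \<Rightarrow> 'a \<Rightarrow> nat" where
  "degree G v = card {e \<in> edges G. v \<in> e}"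

definition le_regular :: "nat \<Rightarrow> 'a ugraph \<Rightarrow> bool" where
  "le_regular r G \<longleftrightarrow> (\<forall>v\<in>verts G. degree G v \<le> r)"

definition ordering :: "'a ugraph \<Rightarrow> ('a set \<Rightarrow> nat) \<Rightarrow> bool" where
  "ordering G l \<longleftrightarrow> bij_betw l (edges G) {..<card (edges G)}"

definition cyc_consecutive :: "'a ugraph \<Rightarrow> ('a set \<Rightarrow> nat) \<Rightarrow> nat \<Rightarrow> nat \<Rightarrow> 'a set set" where
  "cyc_consecutive G l i s = {e \<in> edges G. \<exists>j<s. l e = (i + j) mod card (edges G)}"

text \<open>The bound on \<open>s\<close> reflects that a graph has no more than \<open>card (edges G)\<close> distinct
  consecutive edges; it keeps the maximum defined when \<open>G\<close> itself has maximum degree at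
  most \<open>r\<close>.\<close>

definition cms_ordering :: "nat \<Rightarrow> 'a ugraph \<Rightarrow> ('a set \<Rightarrow> nat) \<Rightarrow> nat" where
  "cms_ordering r G l =
     Max {s. s \<le> card (edges G) \<and>
             (\<forall>i<card (edges G). le_regular r (verts G, cyc_consecutive G l i s))}"

definition cms :: "nat \<Rightarrow> 'a ugraph \<Rightarrow> nat" where
  "cms r G = Max {cms_ordering r G l | l. ordering G l}"

lemma simple_graph_complete_graph: "simple_graph (complete_graph n)"
  by (simp add: simple_graph_def complete_graph_def)

lemma card_cyc_consecutive:
  assumes "ordering G l" "s \<le> card (edges G)"
  shows "card (cyc_consecutive G l i s) = s"
proof -
  let ?m = "card (edges G)"
  let ?f = "\<lambda>j. (i + j) mod ?m"
  have bij: "bij_betw l (edges G) {..<?m}"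
    using assms(1) by (simp add: ordering_def)
  have inj: "inj_on ?f {..<s}"
  proof (rule inj_onI)
    fix a b assume ab: "a \<in> {..<s}" "b \<in> {..<s}" "?f a = ?f b"
    have "a = b" if "a \<le> b" "b < s" "?f a = ?f b" for a b
    proof -
      have "?m dvd (i + b) - (i + a)"
        using that by (metis add_le_cancel_left mod_eq_dvd_iff_nat)
      then have "?m dvd b - a" by simp
      moreover have "b - a < ?m" using that assms(2) by linarith
      ultimately show ?thesis using that(1) by (meson diff_is_0_eq dvd_imp_le gr0I le_antisym not_le)
    qed
    then show "a = b" using ab by (metis lessThan_iff nat_le_linear)
  qed
  have "l ` cyc_consecutive G l i s = ?f ` {..<s}"
  proof (intro equalityI subsetI)
    fix x assume "x \<in> l ` cyc_consecutive G l i s"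
    then show "x \<in> ?f ` {..<s}" by (auto simp: cyc_consecutive_def)
  next
    fix x assume "x \<in> ?f ` {..<s}"
    then obtain j where j: "j < s" "x = ?f j" by auto
    then have "x \<in> {..<?m}" using assms(2) by simp
    then obtain e where "e \<in> edges G" "x = l e"
      using bij unfolding bij_betw_def by blast
    then show "x \<in> l ` cyc_consecutive G l i s"
      using j unfolding cyc_consecutive_def by blast
  qed
  moreover have "inj_on l (cyc_consecutive G l i s)"
    using bij unfolding cyc_consecutive_def bij_betw_def by (auto intro: inj_on_subset)
  ultimately have "card (cyc_consecutive G l i s) = card (?f ` {..<s})"
    by (metis card_image)
  then show ?thesis using inj by (simp add: card_image)
qed

lemma cms_ordering_set:
  "finite {s. s \<le> card (edges G) \<and>
     (\<forall>i<card (edges G). le_regular r (verts G, cyc_consecutive G l i s))}"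
  "0 \<in> {s. s \<le> card (edges G) \<and>
     (\<forall>i<card (edges G). le_regular r (verts G, cyc_consecutive G l i s))}"
  by (auto simp: le_regular_def degree_def cyc_consecutive_def)

lemma cms_ordering_le: "cms_ordering r G l \<le> card (edges G)"
  using Max_in[OF cms_ordering_set(1), of G r l] cms_ordering_set(2)[of G r l]
  unfolding cms_ordering_def by blast

lemma cms_set_finite: "finite {cms_ordering r G l | l. ordering G l}"
  by (rule finite_subset[of _ "{..card (edges G)}"]) (auto simp: cms_ordering_le)

lemma cms_set_nonempty:
  assumes "simple_graph G"
  shows "{cms_ordering r G l | l. ordering G l} \<noteq> {}"
proof -
  have "finite (edges G)"
    using assms unfolding simple_graph_def
    by (intro finite_subset[of "edges G" "Pow (verts G)"]) auto
  then obtain h where "bij_betw h (edges G) {0..<card (edges G)}"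
    using ex_bij_betw_finite_nat by blast
  then show ?thesis by (auto simp: ordering_def atLeast0LessThan)
qed

end

theory Submission
  imports Defs
begin

text \<open>Put \<open>s = (rn - 1)/2\<close>, \<open>t = ((n-1-r)n - 1)/2\<close> and \<open>N = n(n-1)/2\<close>, so that \<open>s + 1 + t = N\<close>.
  An ordering whose windows of length \<open>s\<close> are all \<open>(\<le> r)\<close>-regular is optimal for \<open>r\<close>, and the same
  ordering is then optimal for \<open>n-1-r\<close>: let \<open>W\<close> be a window of length \<open>s + 1\<close>, with first edge \<open>e\<close>
  and last edge \<open>f\<close>. Both \<open>W - {e}\<close> and \<open>W - {f}\<close> are \<open>(\<le> r)\<close>-regular, so all degrees in \<open>W\<close> are at
  most \<open>r + 1\<close>, and only a vertex of \<open>e \<inter> f\<close>, of which there is at most one, can have degree \<open>r + 1\<close>.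
  As the degrees of \<open>W\<close> sum to \<open>rn + 1\<close>, all of them are at least \<open>r\<close>, so the complement of \<open>W\<close>,
  an arbitrary window of length \<open>t\<close>, is \<open>(\<le> n-1-r)\<close>-regular.\<close>

section \<open>Edge counts and degrees in complete graphs\<close>

lemma finite_edges_complete_graph: "finite (edges (complete_graph n))"
  by (rule finite_subset[of _ "Pow {..<n}"]) (auto simp: complete_graph_def)

lemma card_edges_complete_graph: "2 * card (edges (complete_graph n)) = n * (n - 1)"
proof -
  have "card (edges (complete_graph n)) = n choose 2"
    using n_subsets[of "{..<n}" 2] by (simp add: complete_graph_def)
  moreover have "even (n * (n - 1))" by auto
  ultimately show ?thesis by (simp add: choose_two)
qed

lemma degree_mono:
  assumes "A \<subseteq> B" "finite B"
  shows "degree (V, A) v \<le> degree (V, B) v"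
  unfolding degree_def using assms by (intro card_mono) auto

lemma degree_Diff_notin:
  assumes "v \<notin> e"
  shows "degree (V, A - {e}) v = degree (V, A) v"
proof -
  have "{x \<in> A - {e}. v \<in> x} = {x \<in> A. v \<in> x}" using assms by auto
  then show ?thesis by (simp add: degree_def)
qed

lemma degree_le_Suc_degree_Diff:
  assumes "finite A"
  shows "degree (V, A) v \<le> Suc (degree (V, A - {e}) v)"
proof -
  have "degree (V, A) v \<le> card (insert e {x \<in> A - {e}. v \<in> x})"
    unfolding degree_def using assms by (intro card_mono) auto
  also have "\<dots> \<le> Suc (degree (V, A - {e}) v)"
    unfolding degree_def using assms by (simp add: card_insert_if)
  finally show ?thesis .
qed

lemma degree_disjoint_Un:
  assumes "finite A" "finite B" "A \<inter> B = {}"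
  shows "degree (V, A \<union> B) v = degree (V, A) v + degree (V, B) v"
proof -
  have "{e \<in> A \<union> B. v \<in> e} = {e \<in> A. v \<in> e} \<union> {e \<in> B. v \<in> e}" by auto
  moreover have "{e \<in> A. v \<in> e} \<inter> {e \<in> B. v \<in> e} = {}" using assms by blast
  ultimately show ?thesis
    unfolding degree_def using assms by (simp add: card_Un_disjoint)
qed

lemma degree_complete_graph_le:
  assumes "v < n"
  shows "degree (complete_graph n) v \<le> n - 1"
proof -
  have "{e \<in> edges (complete_graph n). v \<in> e} \<subseteq> (\<lambda>u. {v, u}) ` ({..<n} - {v})"
    by (auto simp: complete_graph_def card_2_iff doubleton_eq_iff)
  then have "degree (complete_graph n) v \<le> card ((\<lambda>u. {v, u}) ` ({..<n} - {v}))"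
    unfolding degree_def by (intro card_mono) auto
  also have "\<dots> \<le> card ({..<n} - {v})" by (intro card_image_le) auto
  finally show ?thesis using assms by simp
qed

text \<open>Double counting of incidences: every edge of \<open>F\<close> has exactly two endpoints,
  both below \<open>n\<close>.\<close>

lemma sum_degree_complete_graph:
  assumes "F \<subseteq> edges (complete_graph n)"
  shows "(\<Sum>v<n. degree (V, F) v) = 2 * card F"
proof -
  have fin: "finite F" using assms finite_edges_complete_graph finite_subset by blast
  have "card {v \<in> {..<n}. v \<in> e} = 2" if "e \<in> F" for e
  proof -
    have "e \<subseteq> {..<n}" "card e = 2" using that assms by (auto simp: complete_graph_def)
    moreover from this have "{v \<in> {..<n}. v \<in> e} = e" by auto
    ultimately show ?thesis by simp
  qed
  then show ?thesis
    unfolding degree_def using sum_multicount[of "{..<n}" F "\<lambda>v e. v \<in> e" 2] fin by simp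
qed

section \<open>Windows of cyclically consecutive edges\<close>

lemma cyc_consecutive_subset: "cyc_consecutive G l i s \<subseteq> edges G"
  by (auto simp: cyc_consecutive_def)

lemma cyc_consecutive_mod:
  "cyc_consecutive G l (i mod card (edges G)) s = cyc_consecutive G l i s"
  unfolding cyc_consecutive_def by (simp only: mod_add_left_eq)

lemma add_mod_neq:
  fixes a b N :: nat
  assumes "a < b" "b < a + N"
  shows "(i + a) mod N \<noteq> (i + b) mod N"
proof
  assume "(i + a) mod N = (i + b) mod N"
  then have "N dvd (i + b) - (i + a)"
    using assms by (metis add_le_cancel_left less_imp_le mod_eq_dvd_iff_nat)
  then show False using assms by (auto dest: dvd_imp_le)
qed

text \<open>The two windows together run through one full cycle of positions, and no label repeats
  within a cycle.\<close>

lemma cyc_consecutive_disjoint: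
  assumes "s + t = card (edges G)"
  shows "cyc_consecutive G l i s \<inter> cyc_consecutive G l (i + s) t = {}"
proof -
  have "(i + j) mod card (edges G) \<noteq> (i + s + k) mod card (edges G)" if "j < s" "k < t" for j k
    using add_mod_neq[of j "s + k" "card (edges G)" i] that assms by (simp add: add.assoc)
  then show ?thesis by (fastforce simp: cyc_consecutive_def)
qed

text \<open>\<open>e\<close> and \<open>f\<close> are the edges at the first and last position,
  \<open>i\<close> and \<open>i + s\<close> modulo the number of edges; the bounds on
  \<open>s\<close> keep these positions distinct.\<close>

lemma cyc_consecutive_Suc_ends:
  assumes l: "ordering G l" and s: "0 < s" "s < card (edges G)"
  obtains e f where "e \<in> edges G" "f \<in> edges G" "e \<noteq> f"
    "cyc_consecutive G l i (Suc s) - {f} \<subseteq> cyc_consecutive G l i s"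
    "cyc_consecutive G l i (Suc s) - {e} \<subseteq> cyc_consecutive G l (Suc i) s"
proof -
  let ?N = "card (edges G)"
  have inj: "inj_on l (edges G)" and im: "l ` edges G = {..<?N}"
    using l by (auto simp: ordering_def bij_betw_def)
  have "i mod ?N \<in> l ` edges G" "(i + s) mod ?N \<in> l ` edges G" using im s by auto
  then obtain e f where ef: "e \<in> edges G" "l e = i mod ?N" "f \<in> edges G" "l f = (i + s) mod ?N"
    by force
  have "e \<noteq> f" using ef add_mod_neq[of 0 s ?N i] s by auto
  moreover have "cyc_consecutive G l i (Suc s) - {f} \<subseteq> cyc_consecutive G l i s"
    using ef inj by (auto simp: cyc_consecutive_def less_Suc_eq inj_on_def)
  moreover have "cyc_consecutive G l i (Suc s) - {e} \<subseteq> cyc_consecutive G l (Suc i) s"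
  proof
    fix x assume x: "x \<in> cyc_consecutive G l i (Suc s) - {e}"
    then obtain j where j: "j < Suc s" "l x = (i + j) mod ?N" "x \<in> edges G" "x \<noteq> e"
      by (auto simp: cyc_consecutive_def)
    \<comment> \<open>Offset 0 carries the label of \<open>e\<close>, and \<open>l\<close> is
      injective.\<close>
    have "j \<noteq> 0" using j ef inj_onD[OF inj, of x e] by (metis add_0_right)
    then obtain k where "j = Suc k" using not0_implies_Suc by blast
    with j show "x \<in> cyc_consecutive G l (Suc i) s" by (auto simp: cyc_consecutive_def)
  qed
  ultimately show ?thesis using ef that by blast
qed

section \<open>Regular windows and their complements\<close>

definition windows_regular :: "nat \<Rightarrow> 'a ugraph \<Rightarrow> ('a set \<Rightarrow> nat) \<Rightarrow> nat \<Rightarrow> bool" where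
  "windows_regular r G l s \<longleftrightarrow>
     (\<forall>i<card (edges G). le_regular r (verts G, cyc_consecutive G l i s))"

text \<open>A window depends only on its start modulo the number of edges, so the start is
  unrestricted here; this admits starts such as \<open>Suc i\<close> and
  \<open>i + t\<close>.\<close>

lemma windows_regularD:
  assumes "windows_regular r G l s" "0 < card (edges G)" "v \<in> verts G"
  shows "degree (verts G, cyc_consecutive G l i s) v \<le> r"
proof -
  have "i mod card (edges G) < card (edges G)" using assms(2) by simp
  then have "le_regular r (verts G, cyc_consecutive G l (i mod card (edges G)) s)"
    using assms(1) unfolding windows_regular_def by blast
  then show ?thesis using assms(3) by (simp add: cyc_consecutive_mod le_regular_def)
qed

text \<open>A vertex of degree below \<open>r\<close> would offset the single possible excess of
  one, leaving a degree sum of at most \<open>r * n\<close>, whereas \<open>s + 1\<close> edges give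
  \<open>2 * s + 2 = r * n + 1\<close>.\<close>

lemma degree_window_ge:
  fixes n r s :: nat
  defines "K \<equiv> complete_graph n"
  assumes l: "ordering K l" and reg: "windows_regular r K l s"
    and s: "r * n = 2 * s + 1" "0 < s" "s < card (edges K)" and v: "v < n"
  shows "r \<le> degree (verts K, cyc_consecutive K l i (Suc s)) v"
proof (rule ccontr)
  let ?W = "cyc_consecutive K l i (Suc s)"
  let ?d = "degree (verts K, ?W)"
  assume "\<not> r \<le> ?d v"
  then have dv: "Suc (?d v) \<le> r" by simp
  have V: "verts K = {..<n}" by (simp add: K_def complete_graph_def)
  have finE: "finite (edges K)" by (simp add: K_def finite_edges_complete_graph)
  have finW: "finite ?W" by (rule finite_subset[OF cyc_consecutive_subset finE])
  have finC: "finite (cyc_consecutive K l j s)" for j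
    by (rule finite_subset[OF cyc_consecutive_subset finE])
  obtain e f where ef: "e \<in> edges K" "f \<in> edges K" "e \<noteq> f"
    "?W - {f} \<subseteq> cyc_consecutive K l i s" "?W - {e} \<subseteq> cyc_consecutive K l (Suc i) s"
    using cyc_consecutive_Suc_ends[OF l s(2,3)] by blast
  have del: "degree (verts K, ?W - {g}) u \<le> r" if "g = e \<or> g = f" "u < n" for g u
  proof -
    obtain j where "?W - {g} \<subseteq> cyc_consecutive K l j s" using ef \<open>g = e \<or> g = f\<close> by blast
    then have "degree (verts K, ?W - {g}) u \<le> degree (verts K, cyc_consecutive K l j s) u"
      by (rule degree_mono[OF _ finC])
    also have "\<dots> \<le> r" using windows_regularD[OF reg] s V \<open>u < n\<close> by simp
    finally show ?thesis .
  qed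
  have le_Suc: "?d u \<le> Suc r" if "u < n" for u
    using degree_le_Suc_degree_Diff[OF finW, of "verts K" u e] del[of e u] that by simp
  \<comment> \<open>Such a \<open>u\<close> misses \<open>e\<close> or \<open>f\<close>, and
    deleting the missed edge does not change its degree.\<close>
  have le: "?d u \<le> r" if "u < n" "u \<notin> e \<inter> f" for u
    using del[of e u] del[of f u] that degree_Diff_notin by (metis IntI)
  have "card e = 2" "card f = 2" using ef by (auto simp: K_def complete_graph_def)
  then have uniq: "u = w" if "u \<in> e \<inter> f" "w \<in> e \<inter> f" for u w
    using that \<open>e \<noteq> f\<close> by (auto simp: card_2_iff)
  have "(\<Sum>u<n. ?d u) \<le> r * n"
  proof (cases "\<exists>w<n. w \<in> e \<inter> f")
    case False
    then have "(\<Sum>u<n. ?d u) \<le> (\<Sum>u<n. r)" by (intro sum_mono le) auto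
    then show ?thesis by (simp add: mult.commute)
  next
    case True
    then obtain w where w: "w < n" "w \<in> e \<inter> f" by blast
    then have le': "?d u \<le> r" if "u < n" "u \<noteq> w" for u using le uniq that by blast
    show ?thesis
    proof (cases "v = w")
      case True
      then have "(\<Sum>u<n. ?d u) \<le> (\<Sum>u<n. r)" using le' dv
        by (intro sum_mono) (metis Suc_leD lessThan_iff)
      then show ?thesis by (simp add: mult.commute)
    next
      case False
      \<comment> \<open>Isolating \<open>v\<close> and \<open>w\<close> pairs deficit with excess:
        their degrees sum to at most \<open>(r - 1) + (r + 1)\<close>.\<close>
      have split: "(\<Sum>u<n. h u) = h v + (h w + (\<Sum>u\<in>{..<n} - {v} - {w}. h u))" for h :: "nat \<Rightarrow> nat"
        using v w False sum.remove[of "{..<n}" v h] sum.remove[of "{..<n} - {v}" w h] by simp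
      have "(\<Sum>u\<in>{..<n} - {v} - {w}. ?d u) \<le> (\<Sum>u\<in>{..<n} - {v} - {w}. r)"
        using le' by (intro sum_mono) auto
      then have "(\<Sum>u<n. ?d u) \<le> (\<Sum>u<n. r)"
        using split[of ?d] split[of "\<lambda>_. r"] dv le_Suc[OF w(1)] by linarith
      then show ?thesis by (simp add: mult.commute)
    qed
  qed
  moreover have "(\<Sum>u<n. ?d u) = 2 * Suc s"
    using sum_degree_complete_graph[of ?W n "verts K"] cyc_consecutive_subset[of K]
      card_cyc_consecutive[OF l, of "Suc s"] s by (simp add: K_def)
  ultimately show False using s by simp
qed

text \<open>The window of length \<open>s + 1\<close> that follows a window of length
  \<open>t\<close> uses at least \<open>r\<close> of the at most \<open>n - 1\<close> edges at each
  vertex.\<close>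

lemma windows_regular_complement:
  fixes n r s t :: nat
  defines "K \<equiv> complete_graph n"
  assumes l: "ordering K l" and reg: "windows_regular r K l s"
    and s: "r * n = 2 * s + 1" "0 < s" and t: "t + Suc s = card (edges K)"
  shows "windows_regular (n - 1 - r) K l t"
proof -
  have finE: "finite (edges K)" by (simp add: K_def finite_edges_complete_graph)
  have "degree (verts K, cyc_consecutive K l i t) v \<le> n - 1 - r" if v: "v < n" for i v
  proof -
    let ?A = "cyc_consecutive K l i t" and ?B = "cyc_consecutive K l (i + t) (Suc s)"
    have sub: "?A \<subseteq> edges K" "?B \<subseteq> edges K" by (rule cyc_consecutive_subset)+
    then have fin: "finite ?A" "finite ?B" using finE finite_subset by blast+
    have "degree (verts K, ?A) v + degree (verts K, ?B) v = degree (verts K, ?A \<union> ?B) v"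
      using degree_disjoint_Un[OF fin cyc_consecutive_disjoint[OF t]] by simp
    also have "\<dots> \<le> degree (verts K, edges K) v"
      using sub finE by (intro degree_mono) auto
    also have "\<dots> \<le> n - 1" using degree_complete_graph_le[OF v] by (simp add: K_def)
    finally show ?thesis
      using degree_window_ge[of n l r s v "i + t"] l reg s t v by (simp add: K_def)
  qed
  then show ?thesis by (auto simp: windows_regular_def le_regular_def K_def complete_graph_def)
qed

text \<open>Degree counting in one regular window of length \<open>k\<close> gives
  \<open>2 * k \<le> r * n = 2 * s + 1\<close>, so no ordering exceeds \<open>s\<close>, and the
  maximum is \<open>s\<close> exactly when some ordering attains it.\<close>

lemma cms_complete_graph_eq_iff:
  fixes n r s :: nat
  defines "K \<equiv> complete_graph n"
  assumes s: "r * n = 2 * s + 1" "s < card (edges K)"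
  shows "cms r K = s \<longleftrightarrow> (\<exists>l. ordering K l \<and> windows_regular r K l s)"
proof -
  let ?S = "\<lambda>l. {k. k \<le> card (edges K) \<and> windows_regular r K l k}"
  have S: "cms_ordering r K l = Max (?S l)" "finite (?S l)" "?S l \<noteq> {}" for l
    using cms_ordering_set[of K r l] by (auto simp: cms_ordering_def windows_regular_def)
  have bound: "k \<le> s" if l: "ordering K l" and k: "k \<in> ?S l" for l k
  proof -
    let ?W = "cyc_consecutive K l 0 k"
    have "2 * k = (\<Sum>v<n. degree (verts K, ?W) v)"
      using sum_degree_complete_graph[of ?W n "verts K"] cyc_consecutive_subset[of K]
        card_cyc_consecutive[OF l] k by (simp add: K_def)
    also have "\<dots> \<le> (\<Sum>v<n. r)"
      using k s windows_regularD[of r K l k] by (intro sum_mono) (auto simp: K_def complete_graph_def)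
    finally show ?thesis using s by (simp add: mult.commute)
  qed
  have in_S: "cms_ordering r K l \<in> ?S l" for l using S Max_in by metis
  have eq: "cms_ordering r K l = s \<longleftrightarrow> windows_regular r K l s" if "ordering K l" for l
  proof
    assume "windows_regular r K l s"
    then have "s \<in> ?S l" using s by simp
    then have "s \<le> cms_ordering r K l" using S by (metis Max_ge)
    then show "cms_ordering r K l = s" using bound[OF that in_S] by simp
  qed (use in_S in auto)
  define C where "C = {cms_ordering r K l | l. ordering K l}"
  have fin: "finite C" and ne: "C \<noteq> {}"
    unfolding C_def K_def by (rule cms_set_finite cms_set_nonempty[OF simple_graph_complete_graph])+
  have C_le: "x \<le> s" if x: "x \<in> C" for x
  proof -
    obtain l where "ordering K l" "x = cms_ordering r K l" using x unfolding C_def by blast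
    then show ?thesis using bound[OF _ in_S] by simp
  qed
  have "Max C = s \<longleftrightarrow> s \<in> C"
    using Max_in[OF fin ne] Max_eqI[OF fin C_le] by auto
  also have "\<dots> \<longleftrightarrow> (\<exists>l. ordering K l \<and> windows_regular r K l s)"
    unfolding C_def using eq by blast
  finally show ?thesis unfolding cms_def C_def .
qed

lemma floor_half_pred:
  assumes "r * n = 2 * s + 1"
  shows "\<lfloor>(real r * real n - 1) / 2\<rfloor> = int s"
proof -
  have "real r * real n = 2 * real s + 1"
    using arg_cong[OF assms, of real] by simp
  then show ?thesis by simp
qed

theorem theorem7:
  fixes n r :: nat
  assumes "n \<ge> 3" and "odd n" and "1 \<le> r" and "r \<le> n - 2" and "odd r"
  shows "int (cms r (complete_graph n)) = \<lfloor>(real r * real n - 1) / 2\<rfloor> \<longleftrightarrow>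
         int (cms (n - 1 - r) (complete_graph n)) = \<lfloor>(real (n - 1 - r) * real n - 1) / 2\<rfloor>"
proof -
  let ?K = "complete_graph n"
  define q where "q = n - 1 - r"
  \<comment> \<open>\<open>r\<close> and \<open>q\<close> play symmetric roles: \<open>q\<close> is
    odd because \<open>n - 1\<close> is even, and complementing twice returns to \<open>r\<close>.
    So one lemma serves both directions.\<close>
  have q: "n - 1 = r + q" "odd q" "n - 1 - q = r" "1 \<le> q" using assms by (auto simp: q_def)
  have "odd (r * n)" "odd (q * n)" using assms q by simp_all
  then obtain s t where s: "r * n = 2 * s + 1" and t: "q * n = 2 * t + 1" by (meson oddE)
  have "2 * card (edges ?K) = r * n + q * n"
    using card_edges_complete_graph[of n] unfolding q(1) by (simp add: algebra_simps)
  then have N: "t + Suc s = card (edges ?K)" using s t by simp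
  \<comment> \<open>This excludes windows of length 0, whose one-edge extensions have coinciding
    ends.\<close>
  have "3 \<le> r * n" "3 \<le> q * n"
    using mult_le_mono[of 1 r 3 n] mult_le_mono[of 1 q 3 n] assms(1,3) q(4) by simp_all
  then have pos: "0 < s" "0 < t" using s t by auto
  have "windows_regular r ?K l s \<longleftrightarrow> windows_regular q ?K l t" if "ordering ?K l" for l
    using windows_regular_complement[of n l r s t] windows_regular_complement[of n l q t s]
      that s t pos N q(3) q_def by (metis add.commute add_Suc_right)
  then have "cms r ?K = s \<longleftrightarrow> cms q ?K = t"
    using cms_complete_graph_eq_iff[OF s] cms_complete_graph_eq_iff[OF t] N by auto
  then show ?thesis using floor_half_pred[OF s] floor_half_pred[OF t] by (simp add: q_def)
qed

end
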